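(* Let $G$ be a finite undirected graph with an isomorphic pair $H_1,H_2\subset V(G)$. If both induced subgraphs $G[V(G)\setminus(H_1\cup H_2)]$ and $G[H_1]$ have tournament anti-Sidorenko (TAS) orientations, then $G$ has a TAS orientation.
   Context: Isomorphic pair: disjoint subsets $H_1,H_2\subset V(G)$ with no edges of $G$ between $H_1$ and $H_2$ form an isomorphic pair if there exist a graph isomorphism $\phi:G[H_1]\to G[H_2]$ of induced subgraphs and vertices $w\in H_1$, $v\in V(G)$ such that the set of edges of $G$ between $H_1\cup H_2$ and $V(G)\setminus(H_1\cup H_2)$ is exactly $\{\{v,w\},\{v,\phi(w)\}\}$. Weighted tournament: a function $A:[n]^2\to[0,1]$ with $A(x,y)+A(y,x)=1$ for all $x,y\in[n]$ (so $A(x,x)=1/2$). For a digraph $D$ with $v(D)$ vertices and $e(D)$ edges, $h_D(A)=\sum_{\phi:V(D)\to[n]}\prod_{(x,y)\in E(D)}A(\phi(x),\phi(y))$. A digraph $D$ is tournament anti-Sidorenko (TAS) if $h_D(A)\le n^{v(D)}/2^{e(D)}$ for every $n$ and every weighted tournament $A$ on $n$ vertices. An orientation of an undirected graph is a digraph obtained by choosing one direction for each edge. *)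

theory Defs
  imports Complex_Main "HOL-Library.FuncSet" "Graph_Theory.Graph_Theory"
begin

text \<open>
  Finite simple undirected graphs are symmetric loop-free finite digraphs without parallel arcs
  (locale \<^locale>\<open>graph\<close>); an undirected edge \<open>{x, y}\<close> is the pair of opposite arcs between
  \<open>x\<close> and \<open>y\<close>.
\<close>

definition edges_between :: "('a, 'b) pre_digraph \<Rightarrow> 'a set \<Rightarrow> 'a set \<Rightarrow> 'a set set" where
  "edges_between G S T = {{x, y} | x y. x \<in> S \<and> y \<in> T \<and> x \<rightarrow>\<^bsub>G\<^esub> y}"

text \<open>
  A library isomorphism \<open>\<phi>\<close> also carries an arc map and the tail and head functions of its
  target. For graphs without parallel arcs this adds nothing to the vertex map \<open>iso_verts \<phi>\<close>:
  \<open>app_iso \<phi> (G \<restriction> H\<^sub>1) = G \<restriction> H\<^sub>2\<close> forces the tail and head functions to be those of \<open>G\<close>, and these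
  determine the arc map. The final equation below forces \<open>v \<notin> H\<^sub>1 \<union> H\<^sub>2\<close>.
\<close>

definition isomorphic_pair :: "('a, 'b) pre_digraph \<Rightarrow> 'a set \<Rightarrow> 'a set \<Rightarrow> bool" where
  "isomorphic_pair G H\<^sub>1 H\<^sub>2 \<longleftrightarrow>
     H\<^sub>1 \<subseteq> verts G \<and> H\<^sub>2 \<subseteq> verts G \<and> H\<^sub>1 \<inter> H\<^sub>2 = {} \<and> edges_between G H\<^sub>1 H\<^sub>2 = {} \<and>
     (\<exists>\<phi>. pre_digraph.digraph_isomorphism (G \<restriction> H\<^sub>1) \<phi> \<and> app_iso \<phi> (G \<restriction> H\<^sub>1) = G \<restriction> H\<^sub>2 \<and>
        (\<exists>w \<in> H\<^sub>1. \<exists>v \<in> verts G.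
           edges_between G (H\<^sub>1 \<union> H\<^sub>2) (verts G - (H\<^sub>1 \<union> H\<^sub>2)) = {{v, w}, {v, iso_verts \<phi> w}}))"

text \<open>The vertex set \<open>[n]\<close> is rendered as \<open>{..<n}\<close>.\<close>

definition weighted_tournament :: "nat \<Rightarrow> (nat \<Rightarrow> nat \<Rightarrow> real) \<Rightarrow> bool" where
  "weighted_tournament n A \<longleftrightarrow>
     (\<forall>x<n. \<forall>y<n. A x y \<in> {0..1} \<and> A x y + A y x = 1)"

definition hom_weight :: "'a pair_pre_digraph \<Rightarrow> nat \<Rightarrow> (nat \<Rightarrow> nat \<Rightarrow> real) \<Rightarrow> real" where
  "hom_weight D n A = (\<Sum>\<phi> \<in> pverts D \<rightarrow>\<^sub>E {..<n}. \<Prod>(x, y) \<in> parcs D. A (\<phi> x) (\<phi> y))"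

definition tournament_anti_sidorenko :: "'a pair_pre_digraph \<Rightarrow> bool" where
  "tournament_anti_sidorenko D \<longleftrightarrow>
     (\<forall>n A. weighted_tournament n A \<longrightarrow>
        hom_weight D n A \<le> real n ^ card (pverts D) / 2 ^ card (parcs D))"

definition orientation_of :: "'a pair_pre_digraph \<Rightarrow> ('a, 'b) pre_digraph \<Rightarrow> bool" where
  "orientation_of D G \<longleftrightarrow>
     pverts D = verts G \<and> parcs D \<subseteq> arcs_ends G \<and>
     (\<forall>x y. x \<rightarrow>\<^bsub>G\<^esub> y \<longrightarrow> ((x, y) \<in> parcs D \<longleftrightarrow> (y, x) \<notin> parcs D))"

definition has_TAS_orientation :: "('a, 'b) pre_digraph \<Rightarrow> bool" where
  "has_TAS_orientation G \<longleftrightarrow> (\<exists>D. orientation_of D G \<and> tournament_anti_sidorenko D)"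

lemma orientation_of_pair_digraph:
  assumes "graph G" "orientation_of D G"
  shows "pair_digraph D"
proof -
  interpret graph G by fact
  have sub: "parcs D \<subseteq> arcs_ends G" and vs: "pverts D = verts G"
    using assms(2) by (auto simp: orientation_of_def)
  have "finite (arcs_ends G)" by (simp add: arcs_ends_def)
  with sub have "finite (parcs D)" by (rule finite_subset)
  show ?thesis
  proof
    fix e assume "e \<in> parcs D"
    with sub have e: "fst e \<rightarrow>\<^bsub>G\<^esub> snd e" by auto
    show "fst e \<in> pverts D" "snd e \<in> pverts D" using adj_in_verts[OF e] vs by simp_all
    show "fst e \<noteq> snd e" using adj_not_same[of "fst e"] e by metis
  qed (use \<open>finite (parcs D)\<close> vs in simp_all)
qed

end

theory Submission
  imports Defs
begin

text \<open>
  Orient \<open>H\<^sub>1\<close> and its copy \<open>H\<^sub>2\<close> identically along \<open>\<phi>\<close>, and direct the two connecting edges as a path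
  \<open>w \<rightarrow> v \<rightarrow> \<phi> w\<close>. For a fixed image \<open>a\<close> of \<open>v\<close>, the two copies contribute
  \<open>P a = \<Sum>h. weight h * A (h w) a\<close> and \<open>Q a = \<Sum>h. weight h * A a (h w)\<close>. Since
  \<open>A x a + A a x = 1\<close>, these add up to the homomorphism weight \<open>F\<close> of \<open>H\<^sub>1\<close>, so \<open>P a * Q a \<le> F\<^sup>2 / 4\<close>
  whatever \<open>a\<close> is, and the two bounds for \<open>V(G) - (H\<^sub>1 \<union> H\<^sub>2)\<close> and \<open>H\<^sub>1\<close> multiply.
\<close>

section \<open>Products over arc sets and sums over extensional maps\<close>

definition arc_prod :: "(nat \<Rightarrow> nat \<Rightarrow> real) \<Rightarrow> ('a \<times> 'a) set \<Rightarrow> ('a \<Rightarrow> nat) \<Rightarrow> real" where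
  "arc_prod A E h = (\<Prod>(x, y) \<in> E. A (h x) (h y))"

lemma hom_weight_arc_prod: "hom_weight D n A = (\<Sum>h \<in> pverts D \<rightarrow>\<^sub>E {..<n}. arc_prod A (parcs D) h)"
  by (simp add: hom_weight_def arc_prod_def)

lemma arc_prod_cong:
  assumes "E \<subseteq> X \<times> X" "\<And>x. x \<in> X \<Longrightarrow> g x = h x"
  shows "arc_prod A E g = arc_prod A E h"
  unfolding arc_prod_def using assms by (intro prod.cong) auto

lemma arc_prod_Un:
  assumes "finite E" "finite E'" "E \<inter> E' = {}"
  shows "arc_prod A (E \<union> E') h = arc_prod A E h * arc_prod A E' h"
  unfolding arc_prod_def using assms by (rule prod.union_disjoint)

lemma arc_prod_map_prod:
  assumes "inj_on \<phi> X" "E \<subseteq> X \<times> X"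
  shows "arc_prod A (map_prod \<phi> \<phi> ` E) h = arc_prod A E (h \<circ> \<phi>)"
proof -
  have "inj_on (map_prod \<phi> \<phi>) E"
    using map_prod_inj_on[OF assms(1) assms(1)] assms(2) by (rule inj_on_subset)
  then show ?thesis
    by (simp add: arc_prod_def prod.reindex case_prod_unfold)
qed

lemma arc_prod_nonneg:
  assumes "weighted_tournament n A" "E \<subseteq> X \<times> X" "h \<in> X \<rightarrow> {..<n}"
  shows "0 \<le> arc_prod A E h"
  unfolding arc_prod_def
proof (rule prod_nonneg, clarify)
  fix x y assume "(x, y) \<in> E"
  then have "h x < n" "h y < n" using assms(2,3) by auto
  then show "0 \<le> A (h x) (h y)" using assms(1) by (auto simp: weighted_tournament_def)
qed

text \<open>A map on a disjoint union is a pair of maps on the parts. The merged map needs no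
  restriction: off \<open>X\<close> it is \<open>k\<close>, which is already undefined off
  \<open>Y\<close>.\<close>

lemma sum_PiE_Un_disjoint:
  assumes "X \<inter> Y = {}"
  shows "(\<Sum>h \<in> X \<union> Y \<rightarrow>\<^sub>E S. f h) =
    (\<Sum>g \<in> X \<rightarrow>\<^sub>E S. \<Sum>k \<in> Y \<rightarrow>\<^sub>E S. f (\<lambda>x. if x \<in> X then g x else k x))"
  unfolding sum.cartesian_product
  by (rule sum.reindex_bij_witness[where j = "\<lambda>h. (restrict h X, restrict h Y)"
        and i = "\<lambda>(g, k) x. if x \<in> X then g x else k x"])
    (use assms in \<open>auto simp: PiE_iff extensional_def fun_eq_iff restrict_def
        intro!: arg_cong[where f = f]\<close>)

text \<open>Precomposition with \<phi> is a bijection between the two spaces of maps. The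
  \<open>restrict\<close> is there because \<open>h \<circ> \<phi>\<close> may take defined values
  outside \<open>X\<close>.\<close>

lemma sum_PiE_image:
  assumes "inj_on \<phi> X"
  shows "(\<Sum>h \<in> \<phi> ` X \<rightarrow>\<^sub>E S. f (restrict (h \<circ> \<phi>) X)) = (\<Sum>h \<in> X \<rightarrow>\<^sub>E S. f h)"
  by (rule sum.reindex_bij_witness[where j = "\<lambda>h. restrict (h \<circ> \<phi>) X"
        and i = "\<lambda>h. restrict (h \<circ> the_inv_into X \<phi>) (\<phi> ` X)"])
    (use assms in \<open>auto simp: PiE_iff extensional_def fun_eq_iff restrict_def
        the_inv_into_f_f\<close>)

section \<open>Attaching two copies of a digraph to a vertex\<close>

definition attach_copies ::
    "'a pair_pre_digraph \<Rightarrow> 'a pair_pre_digraph \<Rightarrow> ('a \<Rightarrow> 'a) \<Rightarrow> 'a \<Rightarrow> 'a \<Rightarrow> 'a pair_pre_digraph" where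
  "attach_copies R D \<phi> v w =
     \<lparr>pverts = pverts R \<union> (pverts D \<union> \<phi> ` pverts D),
      parcs = parcs R \<union> (parcs D \<union> (map_prod \<phi> \<phi> ` parcs D \<union> {(w, v), (v, \<phi> w)}))\<rparr>"

text \<open>The digraph side of the construction, separated from the graph: \<open>R\<close> is to
  orient the remaining vertices and \<open>D\<close> the part \<open>H\<^sub>1\<close>. That \<phi>
  preserves adjacency enters only when the result has to orient \<open>G\<close>.\<close>

locale attachment =
  fixes R D :: "'a pair_pre_digraph" and \<phi> :: "'a \<Rightarrow> 'a" and v w :: 'a
  assumes finite_verts: "finite (pverts R)" "finite (pverts D)"
    and arcs_R: "parcs R \<subseteq> pverts R \<times> pverts R"
    and arcs_D: "parcs D \<subseteq> pverts D \<times> pverts D"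
    and inj: "inj_on \<phi> (pverts D)"
    and disjoint_R_D: "pverts R \<inter> pverts D = {}"
    and disjoint_R_copy: "pverts R \<inter> \<phi> ` pverts D = {}"
    and disjoint_D_copy: "pverts D \<inter> \<phi> ` pverts D = {}"
    and v: "v \<in> pverts R" and w: "w \<in> pverts D"
begin

lemma finite_arcs: "finite (parcs R)" "finite (parcs D)"
  using finite_verts arcs_R arcs_D by (auto intro: finite_subset)

lemma arcs_copy: "map_prod \<phi> \<phi> ` parcs D \<subseteq> \<phi> ` pverts D \<times> \<phi> ` pverts D"
  using arcs_D by auto

text \<open>Each connecting arc has one end in \<open>R\<close> and one in a copy, so it lies in no
  block. The facts follow the nesting of the unions in \<open>attach_copies\<close>, so that
  cardinalities and products split by rewriting.\<close>

lemma arcs_disjoint: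
  "parcs R \<inter> (parcs D \<union> (map_prod \<phi> \<phi> ` parcs D \<union> {(w, v), (v, \<phi> w)})) = {}"
  "parcs D \<inter> (map_prod \<phi> \<phi> ` parcs D \<union> {(w, v), (v, \<phi> w)}) = {}"
  "map_prod \<phi> \<phi> ` parcs D \<inter> {(w, v), (v, \<phi> w)} = {}"
  "(w, v) \<noteq> (v, \<phi> w)"
  using arcs_R arcs_D arcs_copy disjoint_R_D disjoint_R_copy disjoint_D_copy v w by blast+

lemma card_verts: "card (pverts (attach_copies R D \<phi> v w)) = card (pverts R) + 2 * card (pverts D)"
proof -
  have "pverts R \<inter> (pverts D \<union> \<phi> ` pverts D) = {}"
    using disjoint_R_D disjoint_R_copy by blast
  then show ?thesis
    using finite_verts disjoint_D_copy
    by (simp add: attach_copies_def card_Un_disjoint card_image[OF inj])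
qed

lemma card_arcs: "card (parcs (attach_copies R D \<phi> v w)) = card (parcs R) + 2 * card (parcs D) + 2"
proof -
  have "card (map_prod \<phi> \<phi> ` parcs D) = card (parcs D)"
    using map_prod_inj_on[OF inj inj] arcs_D by (metis card_image inj_on_subset)
  moreover have "card {(w, v), (v, \<phi> w)} = 2"
    using arcs_disjoint(4) by simp
  ultimately show ?thesis
    using finite_arcs arcs_disjoint
    \<comment> \<open>The deleted rule would dissolve the union with the two connecting arcs into
      insertions, and the disjointness facts would no longer match.\<close>
    by (simp add: attach_copies_def card_Un_disjoint del: Un_insert_right)
qed

text \<open>Each connecting arc is grouped with the copy it enters or leaves, so that the copies
  interact only through \<open>h v\<close>.\<close>

lemma arc_prod_attach_copies:
  "arc_prod A (parcs (attach_copies R D \<phi> v w)) h =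
     arc_prod A (parcs R) h * (arc_prod A (parcs D) h * A (h w) (h v)) *
     (arc_prod A (parcs D) (h \<circ> \<phi>) * A (h v) (h (\<phi> w)))"
proof -
  have "arc_prod A {(w, v), (v, \<phi> w)} h = A (h w) (h v) * A (h v) (h (\<phi> w))"
    using arcs_disjoint(4) by (simp add: arc_prod_def)
  then show ?thesis
    using finite_arcs arcs_disjoint
    by (simp add: attach_copies_def arc_prod_Un arc_prod_map_prod[OF inj arcs_D]
        del: Un_insert_right)
qed

text \<open>Once \<open>g\<close> is fixed, the maps on the two copies vary independently, so their
  double sum factors. The sum over the second copy is pulled back along \<phi> to a sum over maps on
  \<open>D\<close>.\<close>

lemma hom_weight_attach_copies:
  "hom_weight (attach_copies R D \<phi> v w) n A =
     (\<Sum>g \<in> pverts R \<rightarrow>\<^sub>E {..<n}. arc_prod A (parcs R) g *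
        ((\<Sum>h \<in> pverts D \<rightarrow>\<^sub>E {..<n}. arc_prod A (parcs D) h * A (h w) (g v)) *
         (\<Sum>h \<in> pverts D \<rightarrow>\<^sub>E {..<n}. arc_prod A (parcs D) h * A (g v) (h w))))"
proof -
  let ?S = "{..<n}" and ?X = "pverts R" and ?Y = "pverts D" and ?Z = "\<phi> ` pverts D"
  let ?m = "\<lambda>g h k x. if x \<in> ?X then g x else if x \<in> ?Y then h x else k x"
  \<comment> \<open>The last factor is written as a function of
    \<open>restrict (k \<circ> \<phi>) ?Y\<close>, the form in which \<open>sum_PiE_image\<close>
    applies.\<close>
  have summand: "arc_prod A (parcs (attach_copies R D \<phi> v w)) (?m g h k) =
      arc_prod A (parcs R) g * ((arc_prod A (parcs D) h * A (h w) (g v)) *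
      (\<lambda>k. arc_prod A (parcs D) k * A (g v) (k w)) (restrict (k \<circ> \<phi>) ?Y))" for g h k
  proof -
    have "arc_prod A (parcs R) (?m g h k) = arc_prod A (parcs R) g"
      by (rule arc_prod_cong[OF arcs_R]) simp
    moreover have "arc_prod A (parcs D) (?m g h k) = arc_prod A (parcs D) h"
      by (rule arc_prod_cong[OF arcs_D]) (use disjoint_R_D in auto)
    moreover have "arc_prod A (parcs D) (?m g h k \<circ> \<phi>) =
        arc_prod A (parcs D) (restrict (k \<circ> \<phi>) ?Y)"
      by (rule arc_prod_cong[OF arcs_D]) (use disjoint_R_copy disjoint_D_copy in auto)
    moreover have "w \<notin> ?X" "\<phi> w \<notin> ?X" "\<phi> w \<notin> ?Y"
      using w disjoint_R_D disjoint_R_copy disjoint_D_copy by auto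
    ultimately show ?thesis
      using v w unfolding arc_prod_attach_copies by (simp add: mult.assoc)
  qed
  have "?X \<inter> (?Y \<union> ?Z) = {}"
    using disjoint_R_D disjoint_R_copy by blast
  moreover have "pverts (attach_copies R D \<phi> v w) = ?X \<union> (?Y \<union> ?Z)"
    by (simp add: attach_copies_def)
  ultimately have "hom_weight (attach_copies R D \<phi> v w) n A =
      (\<Sum>g \<in> ?X \<rightarrow>\<^sub>E ?S. \<Sum>h \<in> ?Y \<rightarrow>\<^sub>E ?S. \<Sum>k \<in> ?Z \<rightarrow>\<^sub>E ?S.
         arc_prod A (parcs (attach_copies R D \<phi> v w)) (?m g h k))"
    by (simp add: hom_weight_arc_prod sum_PiE_Un_disjoint disjoint_D_copy)
  moreover have "(\<Sum>k \<in> ?Z \<rightarrow>\<^sub>E ?S. arc_prod A (parcs D) (restrict (k \<circ> \<phi>) ?Y) *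
        A a (restrict (k \<circ> \<phi>) ?Y w)) = (\<Sum>k \<in> ?Y \<rightarrow>\<^sub>E ?S. arc_prod A (parcs D) k * A a (k w))" for a
    by (rule sum_PiE_image[OF inj])
  ultimately show ?thesis
    unfolding summand sum_distrib_left[symmetric] sum_distrib_right[symmetric] by simp
qed

lemma tournament_anti_sidorenko_attach_copies:
  assumes "tournament_anti_sidorenko R" "tournament_anti_sidorenko D"
  shows "tournament_anti_sidorenko (attach_copies R D \<phi> v w)"
  unfolding tournament_anti_sidorenko_def
proof (intro allI impI)
  fix n A assume A: "weighted_tournament n A"
  let ?S = "{..<n}"
  let ?F = "hom_weight D n A"
  let ?P = "\<lambda>a. \<Sum>h \<in> pverts D \<rightarrow>\<^sub>E ?S. arc_prod A (parcs D) h * A (h w) a"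
  let ?Q = "\<lambda>a. \<Sum>h \<in> pverts D \<rightarrow>\<^sub>E ?S. arc_prod A (parcs D) h * A a (h w)"
  have R_nonneg: "0 \<le> arc_prod A (parcs R) g" if "g \<in> pverts R \<rightarrow>\<^sub>E ?S" for g
    using arc_prod_nonneg[OF A arcs_R] that by (auto simp: PiE_def)
  have D_nonneg: "0 \<le> arc_prod A (parcs D) h" if "h \<in> pverts D \<rightarrow>\<^sub>E ?S" for h
    using arc_prod_nonneg[OF A arcs_D] that by (auto simp: PiE_def)
  \<comment> \<open>Allows the upper bound on \<open>?F\<close> to be squared below.\<close>
  have F_nonneg: "0 \<le> ?F"
    unfolding hom_weight_arc_prod by (intro sum_nonneg D_nonneg)
  have PQ: "?P a * ?Q a \<le> ?F\<^sup>2 / 4" if "a < n" for a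
  proof -
    have "?P a + ?Q a = ?F"
      unfolding hom_weight_arc_prod sum.distrib[symmetric]
    proof (rule sum.cong[OF refl])
      fix h assume "h \<in> pverts D \<rightarrow>\<^sub>E ?S"
      then have "h w < n" using w by auto
      with A that have "A (h w) a + A a (h w) = 1" by (simp add: weighted_tournament_def)
      then show "arc_prod A (parcs D) h * A (h w) a + arc_prod A (parcs D) h * A a (h w) =
          arc_prod A (parcs D) h"
        by (metis distrib_left mult.right_neutral)
    qed
    \<comment> \<open>AM-GM in the form
      \<open>4 * P * Q = (P + Q)\<^sup>2 - (P - Q)\<^sup>2\<close>.\<close>
    moreover have "0 \<le> (?P a - ?Q a)\<^sup>2" by simp
    then have "?P a * ?Q a \<le> (?P a + ?Q a)\<^sup>2 / 4"
      by (simp add: power2_eq_square algebra_simps)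
    ultimately show ?thesis by metis
  qed
  have "hom_weight (attach_copies R D \<phi> v w) n A \<le>
      (\<Sum>g \<in> pverts R \<rightarrow>\<^sub>E ?S. arc_prod A (parcs R) g * (?F\<^sup>2 / 4))"
    unfolding hom_weight_attach_copies
    by (intro sum_mono mult_left_mono PQ R_nonneg) (use v in auto)
  also have "\<dots> = hom_weight R n A * (?F\<^sup>2 / 4)"
    by (simp only: hom_weight_arc_prod sum_distrib_right)
  also have "\<dots> \<le> (real n ^ card (pverts R) / 2 ^ card (parcs R)) *
      ((real n ^ card (pverts D) / 2 ^ card (parcs D))\<^sup>2 / 4)"
    using assms A F_nonneg
    by (intro mult_mono divide_right_mono power_mono) (auto simp: tournament_anti_sidorenko_def)
  \<comment> \<open>The factor \<open>1 / 4\<close> accounts exactly for the two connecting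
    arcs.\<close>
  also have "\<dots> = real n ^ card (pverts (attach_copies R D \<phi> v w)) /
      2 ^ card (parcs (attach_copies R D \<phi> v w))"
    by (simp add: card_verts card_arcs power_add power_divide power_mult[symmetric] mult.commute)
  finally show "hom_weight (attach_copies R D \<phi> v w) n A \<le>
      real n ^ card (pverts (attach_copies R D \<phi> v w)) /
      2 ^ card (parcs (attach_copies R D \<phi> v w))" .
qed

end

section \<open>Orienting the whole graph\<close>

lemma arcs_ends_induce_subgraph: "arcs_ends (G \<restriction> S) = arcs_ends G \<inter> S \<times> S"
  by (auto simp: arcs_ends_conv)

lemma orientation_of_induce_subgraph_iff:
  "orientation_of D (G \<restriction> S) \<longleftrightarrow> pverts D = S \<and> parcs D \<subseteq> arcs_ends G \<inter> S \<times> S \<and>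
     (\<forall>x\<in>S. \<forall>y\<in>S. x \<rightarrow>\<^bsub>G\<^esub> y \<longrightarrow> ((x, y) \<in> parcs D \<longleftrightarrow> (y, x) \<notin> parcs D))"
  by (auto simp: orientation_of_def arcs_ends_induce_subgraph)

theorem theorem1p3:
  fixes G :: "('a, 'b) pre_digraph" and H\<^sub>1 H\<^sub>2 :: "'a set"
  assumes "graph G"
    and "isomorphic_pair G H\<^sub>1 H\<^sub>2"
    and "has_TAS_orientation (G \<restriction> (verts G - (H\<^sub>1 \<union> H\<^sub>2)))"
    and "has_TAS_orientation (G \<restriction> H\<^sub>1)"
  shows "has_TAS_orientation G"
proof -
  interpret graph G by fact
  let ?R = "verts G - (H\<^sub>1 \<union> H\<^sub>2)"
  obtain \<psi> w v where H: "H\<^sub>1 \<subseteq> verts G" "H\<^sub>2 \<subseteq> verts G" "H\<^sub>1 \<inter> H\<^sub>2 = {}" "edges_between G H\<^sub>1 H\<^sub>2 = {}"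
    and \<psi>: "pre_digraph.digraph_isomorphism (G \<restriction> H\<^sub>1) \<psi>" "app_iso \<psi> (G \<restriction> H\<^sub>1) = G \<restriction> H\<^sub>2"
    and w: "w \<in> H\<^sub>1"
    and cut: "edges_between G (H\<^sub>1 \<union> H\<^sub>2) ?R = {{v, w}, {v, iso_verts \<psi> w}}"
    using assms(2) unfolding isomorphic_pair_def by (elim conjE exE bexE) (rule that)
  define \<phi> where "\<phi> = iso_verts \<psi>"
  have inj: "inj_on \<phi> H\<^sub>1"
    using pre_digraph.digraph_isomorphism_inj_on_verts[OF \<psi>(1)] by (simp add: \<phi>_def)
  have img: "\<phi> ` H\<^sub>1 = H\<^sub>2"
    using arg_cong[OF \<psi>(2), of verts] by (simp add: \<phi>_def)
  \<comment> \<open>Both inclusions matter: copied arcs are arcs of \<open>G\<close>, and every arc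
    inside \<open>H\<^sub>2\<close> is a copy.\<close>
  have arcs_img: "arcs_ends G \<inter> H\<^sub>2 \<times> H\<^sub>2 = map_prod \<phi> \<phi> ` (arcs_ends G \<inter> H\<^sub>1 \<times> H\<^sub>1)"
    using wf_digraph.arcs_ends_app_iso_eq[OF wellformed_induce_subgraph \<psi>(1)]
    by (simp add: \<psi>(2) arcs_ends_induce_subgraph \<phi>_def map_prod_def)
  obtain D\<^sub>R where D\<^sub>R: "orientation_of D\<^sub>R (G \<restriction> ?R)" "tournament_anti_sidorenko D\<^sub>R"
    using assms(3) by (auto simp: has_TAS_orientation_def)
  obtain D\<^sub>1 where D\<^sub>1: "orientation_of D\<^sub>1 (G \<restriction> H\<^sub>1)" "tournament_anti_sidorenko D\<^sub>1"
    using assms(4) by (auto simp: has_TAS_orientation_def)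
  note or_R = D\<^sub>R(1)[unfolded orientation_of_induce_subgraph_iff]
    and or_1 = D\<^sub>1(1)[unfolded orientation_of_induce_subgraph_iff]
  have sym: "y \<rightarrow>\<^bsub>G\<^esub> x" if "x \<rightarrow>\<^bsub>G\<^esub> y" for x y
    using graph_symmetric that .
  have \<phi>w: "\<phi> w \<in> H\<^sub>2" using w img by auto
  \<comment> \<open>Each of these edges has an end in \<open>?R\<close>. As \<open>w\<close> is not
    in \<open>?R\<close>, that end of the first edge is \<open>v\<close>.\<close>
  have "{v, w} \<in> edges_between G (H\<^sub>1 \<union> H\<^sub>2) ?R" "{v, \<phi> w} \<in> edges_between G (H\<^sub>1 \<union> H\<^sub>2) ?R"
    by (simp_all add: cut \<phi>_def)
  then have v: "v \<in> ?R" and wv: "w \<rightarrow>\<^bsub>G\<^esub> v" and v\<phi>w: "v \<rightarrow>\<^bsub>G\<^esub> \<phi> w"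
    using w \<phi>w sym by (auto simp: edges_between_def doubleton_eq_iff)
  have crossing: "x \<in> {w, \<phi> w} \<and> y = v" if "x \<in> H\<^sub>1 \<union> H\<^sub>2" "y \<in> ?R" "x \<rightarrow>\<^bsub>G\<^esub> y" for x y
  proof -
    have "{x, y} \<in> {{v, w}, {v, \<phi> w}}"
      using that unfolding \<phi>_def cut[symmetric] edges_between_def by blast
    then show ?thesis using that v by (auto simp: doubleton_eq_iff)
  qed
  have separated: "\<not> x \<rightarrow>\<^bsub>G\<^esub> y" if "x \<in> H\<^sub>1" "y \<in> H\<^sub>2" for x y
    using H(4) that by (auto simp: edges_between_def)
  interpret attached: attachment D\<^sub>R D\<^sub>1 \<phi> v w
    using or_R or_1 H img inj v w finite_subset[OF H(1)]
    by unfold_locales auto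
  let ?D = "attach_copies D\<^sub>R D\<^sub>1 \<phi> v w"
  define C where "C = map_prod \<phi> \<phi> ` parcs D\<^sub>1"
  have arcs_D': "(x, y) \<in> parcs ?D \<longleftrightarrow> (x, y) \<in> parcs D\<^sub>R \<or> (x, y) \<in> parcs D\<^sub>1 \<or> (x, y) \<in> C \<or>
      x = w \<and> y = v \<or> x = v \<and> y = \<phi> w" for x y
    by (simp add: attach_copies_def C_def disj_ac)
  have sub_R: "x \<in> ?R" "y \<in> ?R" if "(x, y) \<in> parcs D\<^sub>R" for x y
    using or_R that by auto
  have sub_1: "x \<in> H\<^sub>1" "y \<in> H\<^sub>1" if "(x, y) \<in> parcs D\<^sub>1" for x y
    using or_1 that by auto
  have sub_2: "x \<in> H\<^sub>2" "y \<in> H\<^sub>2" if "(x, y) \<in> C" for x y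
    using sub_1 img that by (auto simp: C_def)
  \<comment> \<open>The blocks containing the two ends of a pair determine which part of
    \<open>?D\<close> can contain it.\<close>
  have in_R: "(x, y) \<in> parcs ?D \<longleftrightarrow> (x, y) \<in> parcs D\<^sub>R" if "x \<in> ?R" "y \<in> ?R" for x y
    using that w \<phi>w unfolding arcs_D' by (auto dest: sub_1 sub_2)
  have in_1: "(x, y) \<in> parcs ?D \<longleftrightarrow> (x, y) \<in> parcs D\<^sub>1" if "x \<in> H\<^sub>1" "y \<in> H\<^sub>1" for x y
    using that v H(3) unfolding arcs_D' by (auto dest: sub_R sub_2)
  have in_2: "(x, y) \<in> parcs ?D \<longleftrightarrow> (x, y) \<in> C" if "x \<in> H\<^sub>2" "y \<in> H\<^sub>2" for x y
    using that v H(3) unfolding arcs_D' by (auto dest: sub_R sub_1)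
  have out: "(x, y) \<in> parcs ?D \<longleftrightarrow> x = w \<and> y = v" "(y, x) \<in> parcs ?D \<longleftrightarrow> y = v \<and> x = \<phi> w"
    if "x \<in> H\<^sub>1 \<union> H\<^sub>2" "y \<in> ?R" for x y
    using that v w \<phi>w unfolding arcs_D' by (auto dest: sub_R sub_1 sub_2)
  \<comment> \<open>Otherwise the two connecting arcs would direct a single edge both ways.\<close>
  have "w \<noteq> \<phi> w" using w \<phi>w H(3) by auto
  have arc_copy: "(\<phi> x, \<phi> y) \<in> C \<longleftrightarrow> (x, y) \<in> parcs D\<^sub>1"
    if "x \<in> H\<^sub>1" "y \<in> H\<^sub>1" for x y
    using inj_on_image_mem_iff[OF map_prod_inj_on[OF attached.inj attached.inj] _ attached.arcs_D, of "(x, y)"] or_1 that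
    by (simp add: C_def)
  have one_direction: "(x, y) \<in> parcs ?D \<longleftrightarrow> (y, x) \<notin> parcs ?D" if xy: "x \<rightarrow>\<^bsub>G\<^esub> y" for x y
  proof -
    have yx: "y \<rightarrow>\<^bsub>G\<^esub> x" using sym[OF xy] .
    have "x \<in> verts G" "y \<in> verts G" using adj_in_verts[OF xy] .
    \<comment> \<open>Pairs with one end in \<open>H\<^sub>1\<close> and the other in
      \<open>H\<^sub>2\<close> are missing because no edge joins these sets.\<close>
    then consider "x \<in> ?R" "y \<in> ?R" | "x \<in> H\<^sub>1" "y \<in> H\<^sub>1" | "x \<in> H\<^sub>2" "y \<in> H\<^sub>2"
      | "x \<in> H\<^sub>1 \<union> H\<^sub>2" "y \<in> ?R" | "x \<in> ?R" "y \<in> H\<^sub>1 \<union> H\<^sub>2"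
      using separated[of x y] separated[of y x] xy yx by blast
    then show ?thesis
    proof cases
      case 1
      then show ?thesis using xy or_R by (simp add: in_R)
    next
      case 2
      then show ?thesis using xy or_1 by (simp add: in_1)
    next
      case 3
      then have "(x, y) \<in> map_prod \<phi> \<phi> ` (arcs_ends G \<inter> H\<^sub>1 \<times> H\<^sub>1)"
        using xy unfolding arcs_img[symmetric] by blast
      then obtain a b where "x = \<phi> a" "y = \<phi> b" "a \<in> H\<^sub>1" "b \<in> H\<^sub>1" "a \<rightarrow>\<^bsub>G\<^esub> b"
        by auto
      then show ?thesis using 3 or_1 by (simp add: in_2 arc_copy)
    next
      case 4
      \<comment> \<open>By \<open>crossing\<close>, \<open>x\<close> is \<open>w\<close> or
        \<open>\<phi> w\<close>; in the first case only the arc into \<open>v\<close> is present, in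
        the second only the arc out of \<open>v\<close>.\<close>
      show ?thesis
        using crossing[OF 4 xy] \<open>w \<noteq> \<phi> w\<close> unfolding out[OF 4] by blast
    next
      case 5
      show ?thesis
        using crossing[OF 5(2,1) yx] \<open>w \<noteq> \<phi> w\<close> unfolding out[OF 5(2,1)] by blast
    qed
  qed
  have "C \<subseteq> arcs_ends G"
    using or_1 arcs_img by (auto simp: C_def)
  then have "parcs ?D \<subseteq> arcs_ends G"
    using or_R or_1 wv v\<phi>w by (auto simp: arcs_D')
  moreover have "pverts ?D = verts G"
    using or_R or_1 img H(1,2) by (auto simp: attach_copies_def)
  ultimately have "orientation_of ?D G"
    using one_direction by (simp add: orientation_of_def)
  then show ?thesis
    using attached.tournament_anti_sidorenko_attach_copies[OF D\<^sub>R(2) D\<^sub>1(2)]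
    unfolding has_TAS_orientation_def by blast
qed

end
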